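(* Let $\mathbf A$ be a Łukasiewicz near semiring and $I$ an ideal of $\mathbf A$. Then the relation $\theta(I)$ defined for $a,b\in A$ by $a\,\theta(I)\,b$ iff $a^{\alpha}b\in I$ and $b^{\alpha}a\in I$ is a congruence on $\mathbf A$, and $[0]_{\theta(I)}=I$.
   Context: An $\iota$-near semiring is an algebra $\langle A,+,\cdot,{}^{\alpha},0,1\rangle$ of type $\langle 2,2,1,0,0\rangle$ such that $\langle A,+\rangle$ is a join semilattice with least element $0$ and greatest element $1$ (order $x\le y$ iff $x+y=y$), $x\cdot1=x=1\cdot x$, $(x+y)\cdot z=xz+yz$, $x0=0x=0$, $(x^{\alpha})^{\alpha}=x$, and $x\le y$ implies $y^{\alpha}\le x^{\alpha}$. A Łukasiewicz near semiring is an $\iota$-near semiring satisfying $(x y^{\alpha})^{\alpha} y^{\alpha}=(y x^{\alpha})^{\alpha} x^{\alpha}$. Juxtaposition $xy$ denotes $x\cdot y$. An ideal of $\mathbf A$ is a set $I\subseteq A$ with $0\in I$ such that (I1) if $ab^{\alpha}\in I$ and $b\in I$ then $a\in I$; (I2) if $a^{\alpha}b\in I$ and $b^{\alpha}a\in I$ then $(ac)^{\alpha}(bc)\in I$ and $(ca)^{\alpha}(cb)\in I$ for every $c\in A$. *)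

theory Defs
  imports "HOL-Algebra.Ring"
begin

record 'a iota_algebra = "'a ring" +
  invol :: "'a \<Rightarrow> 'a"  (\<open>_\<^sup>\<alpha>\<index>\<close> [1000] 999)

definition join_le :: "('a, 'm) ring_scheme \<Rightarrow> 'a \<Rightarrow> 'a \<Rightarrow> bool"  (infix \<open>\<sqsubseteq>\<^sub>+\<index>\<close> 50)
  where "x \<sqsubseteq>\<^sub>+\<^bsub>A\<^esub> y \<longleftrightarrow> x \<oplus>\<^bsub>A\<^esub> y = y"

text \<open>Multiplication is neither associative nor commutative in general, and only right
  distributivity is required.\<close>

locale iota_near_semiring =
  fixes A :: "('a, 'm) iota_algebra_scheme" (structure)
  assumes add_closed: "\<lbrakk>x \<in> carrier A; y \<in> carrier A\<rbrakk> \<Longrightarrow> x \<oplus> y \<in> carrier A"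
    and mult_closed: "\<lbrakk>x \<in> carrier A; y \<in> carrier A\<rbrakk> \<Longrightarrow> x \<otimes> y \<in> carrier A"
    and invol_closed: "x \<in> carrier A \<Longrightarrow> x\<^sup>\<alpha> \<in> carrier A"
    and zero_closed: "\<zero> \<in> carrier A"
    and one_closed: "\<one> \<in> carrier A"
    and add_assoc: "\<lbrakk>x \<in> carrier A; y \<in> carrier A; z \<in> carrier A\<rbrakk>
      \<Longrightarrow> (x \<oplus> y) \<oplus> z = x \<oplus> (y \<oplus> z)"
    and add_comm: "\<lbrakk>x \<in> carrier A; y \<in> carrier A\<rbrakk> \<Longrightarrow> x \<oplus> y = y \<oplus> x"
    and add_idem: "x \<in> carrier A \<Longrightarrow> x \<oplus> x = x"
    and zero_least: "x \<in> carrier A \<Longrightarrow> \<zero> \<sqsubseteq>\<^sub>+ x"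
    and one_greatest: "x \<in> carrier A \<Longrightarrow> x \<sqsubseteq>\<^sub>+ \<one>"
    and mult_one_right: "x \<in> carrier A \<Longrightarrow> x \<otimes> \<one> = x"
    and mult_one_left: "x \<in> carrier A \<Longrightarrow> \<one> \<otimes> x = x"
    and right_distrib: "\<lbrakk>x \<in> carrier A; y \<in> carrier A; z \<in> carrier A\<rbrakk>
      \<Longrightarrow> (x \<oplus> y) \<otimes> z = (x \<otimes> z) \<oplus> (y \<otimes> z)"
    and mult_zero_right: "x \<in> carrier A \<Longrightarrow> x \<otimes> \<zero> = \<zero>"
    and mult_zero_left: "x \<in> carrier A \<Longrightarrow> \<zero> \<otimes> x = \<zero>"
    and invol_invol: "x \<in> carrier A \<Longrightarrow> (x\<^sup>\<alpha>)\<^sup>\<alpha> = x"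
    and invol_antitone: "\<lbrakk>x \<in> carrier A; y \<in> carrier A; x \<sqsubseteq>\<^sub>+ y\<rbrakk> \<Longrightarrow> y\<^sup>\<alpha> \<sqsubseteq>\<^sub>+ x\<^sup>\<alpha>"

locale lukasiewicz_near_semiring = iota_near_semiring +
  assumes lukasiewicz: "\<lbrakk>x \<in> carrier A; y \<in> carrier A\<rbrakk>
    \<Longrightarrow> (x \<otimes> y\<^sup>\<alpha>)\<^sup>\<alpha> \<otimes> y\<^sup>\<alpha> = (y \<otimes> x\<^sup>\<alpha>)\<^sup>\<alpha> \<otimes> x\<^sup>\<alpha>"

definition near_semiring_ideal :: "'a set \<Rightarrow> ('a, 'm) iota_algebra_scheme \<Rightarrow> bool"
  where "near_semiring_ideal I A \<longleftrightarrow>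
    I \<subseteq> carrier A \<and> \<zero>\<^bsub>A\<^esub> \<in> I \<and>
    (\<forall>a \<in> carrier A. \<forall>b \<in> carrier A. a \<otimes>\<^bsub>A\<^esub> b\<^sup>\<alpha>\<^bsub>A\<^esub> \<in> I \<and> b \<in> I \<longrightarrow> a \<in> I) \<and>
    (\<forall>a \<in> carrier A. \<forall>b \<in> carrier A.
      a\<^sup>\<alpha>\<^bsub>A\<^esub> \<otimes>\<^bsub>A\<^esub> b \<in> I \<and> b\<^sup>\<alpha>\<^bsub>A\<^esub> \<otimes>\<^bsub>A\<^esub> a \<in> I \<longrightarrow>
      (\<forall>c \<in> carrier A.
        (a \<otimes>\<^bsub>A\<^esub> c)\<^sup>\<alpha>\<^bsub>A\<^esub> \<otimes>\<^bsub>A\<^esub> (b \<otimes>\<^bsub>A\<^esub> c) \<in> I \<and>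
        (c \<otimes>\<^bsub>A\<^esub> a)\<^sup>\<alpha>\<^bsub>A\<^esub> \<otimes>\<^bsub>A\<^esub> (c \<otimes>\<^bsub>A\<^esub> b) \<in> I))"

definition ideal_rel :: "('a, 'm) iota_algebra_scheme \<Rightarrow> 'a set \<Rightarrow> ('a \<times> 'a) set"  (\<open>\<theta>\<index>\<close>)
  where "\<theta>\<^bsub>A\<^esub> I = {(a, b). a \<in> carrier A \<and> b \<in> carrier A \<and>
    a\<^sup>\<alpha>\<^bsub>A\<^esub> \<otimes>\<^bsub>A\<^esub> b \<in> I \<and> b\<^sup>\<alpha>\<^bsub>A\<^esub> \<otimes>\<^bsub>A\<^esub> a \<in> I}"

definition near_semiring_congruence :: "('a \<times> 'a) set \<Rightarrow> ('a, 'm) iota_algebra_scheme \<Rightarrow> bool"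
  where "near_semiring_congruence r A \<longleftrightarrow>
    equiv (carrier A) r \<and>
    (\<forall>a b c d. (a, b) \<in> r \<and> (c, d) \<in> r \<longrightarrow> (a \<oplus>\<^bsub>A\<^esub> c, b \<oplus>\<^bsub>A\<^esub> d) \<in> r) \<and>
    (\<forall>a b c d. (a, b) \<in> r \<and> (c, d) \<in> r \<longrightarrow> (a \<otimes>\<^bsub>A\<^esub> c, b \<otimes>\<^bsub>A\<^esub> d) \<in> r) \<and>
    (\<forall>a b. (a, b) \<in> r \<longrightarrow> (a\<^sup>\<alpha>\<^bsub>A\<^esub>, b\<^sup>\<alpha>\<^bsub>A\<^esub>) \<in> r)"

end

theory Submission
  imports Defs
begin

text \<open>For all \<open>x, y\<close> the element \<open>((x y\<^sup>\<alpha>)\<^sup>\<alpha> y\<^sup>\<alpha>)\<^sup>\<alpha>\<close> is the join \<open>x + y\<close>, so compatibility with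
  addition follows from compatibility with multiplication and involution. By (I2) the relation
  \<open>\<theta>(I)\<close> is compatible with one-sided multiplication. As \<open>b b\<^sup>\<alpha> = 0\<close>, multiplying \<open>a \<theta> b\<close> on the
  right by \<open>b\<^sup>\<alpha>\<close> gives \<open>a b\<^sup>\<alpha> \<in> I\<close>; this yields both compatibility with the involution and, by (I1),
  that \<open>I\<close> is saturated. If \<open>a \<theta> b \<theta> c\<close>, then \<open>a\<^sup>\<alpha> c \<theta> b\<^sup>\<alpha> c \<in> I\<close>, hence \<open>a\<^sup>\<alpha> c \<in> I\<close>, which is
  transitivity.\<close>

context iota_near_semiring
begin

lemmas closed = add_closed mult_closed invol_closed zero_closed one_closed

lemma join_le_antisym:
  assumes "x \<in> carrier A" "y \<in> carrier A" "x \<sqsubseteq>\<^sub>+ y" "y \<sqsubseteq>\<^sub>+ x"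
  shows "x = y"
  using assms add_comm[of x y] by (simp add: join_le_def)

lemma join_upper_left:
  assumes "x \<in> carrier A" "y \<in> carrier A"
  shows "x \<sqsubseteq>\<^sub>+ x \<oplus> y"
  using assms add_assoc[of x x y] by (simp add: join_le_def add_idem)

lemma join_upper_right:
  assumes "x \<in> carrier A" "y \<in> carrier A"
  shows "y \<sqsubseteq>\<^sub>+ x \<oplus> y"
  using assms join_upper_left[of y x] add_comm[of x y] by simp

lemma join_least:
  assumes "x \<in> carrier A" "y \<in> carrier A" "z \<in> carrier A" "x \<sqsubseteq>\<^sub>+ z" "y \<sqsubseteq>\<^sub>+ z"
  shows "x \<oplus> y \<sqsubseteq>\<^sub>+ z"
  using assms add_assoc[of x y z] by (simp add: join_le_def)

lemma mult_right_mono: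
  assumes "x \<in> carrier A" "y \<in> carrier A" "z \<in> carrier A" "x \<sqsubseteq>\<^sub>+ y"
  shows "x \<otimes> z \<sqsubseteq>\<^sub>+ y \<otimes> z"
  using assms right_distrib[of x y z] by (simp add: join_le_def)

text \<open>Right monotonicity applied to \<open>x \<sqsubseteq>\<^sub>+ \<one>\<close>. It bounds a
  product by its right factor, which makes the meet term below a lower bound.\<close>

lemma mult_le_right:
  assumes "x \<in> carrier A" "y \<in> carrier A"
  shows "x \<otimes> y \<sqsubseteq>\<^sub>+ y"
  using mult_right_mono[of x \<one> y] assms one_greatest[of x]
  by (simp add: one_closed mult_one_left)

lemma invol_zero: "\<zero>\<^sup>\<alpha> = \<one>"
proof (rule join_le_antisym)
  \<comment> \<open>Reverse \<open>\<zero> \<sqsubseteq>\<^sub>+ \<one>\<^sup>\<alpha>\<close> and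
    cancel the double involution.\<close>
  show "\<one> \<sqsubseteq>\<^sub>+ \<zero>\<^sup>\<alpha>"
    using invol_antitone[of \<zero> "\<one>\<^sup>\<alpha>"] zero_least[of "\<one>\<^sup>\<alpha>"] by (simp add: closed invol_invol)
qed (simp_all add: closed one_greatest)

lemma invol_one: "\<one>\<^sup>\<alpha> = \<zero>"
  using invol_invol[of \<zero>] by (simp add: invol_zero zero_closed)

end

context lukasiewicz_near_semiring
begin

text \<open>In the Lukasiewicz identity with \<open>y = \<one>\<close>, the left side vanishes
  because \<open>\<one>\<^sup>\<alpha> = \<zero>\<close>, and the right side becomes
  \<open>x \<otimes> x\<^sup>\<alpha>\<close>.\<close>

lemma mult_invol_right:
  assumes "x \<in> carrier A"
  shows "x \<otimes> x\<^sup>\<alpha> = \<zero>"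
  using lukasiewicz[of x \<one>] assms
  by (simp add: closed invol_one mult_zero_right mult_one_left invol_invol)

lemma mult_invol_left:
  assumes "x \<in> carrier A"
  shows "x\<^sup>\<alpha> \<otimes> x = \<zero>"
  using mult_invol_right[of "x\<^sup>\<alpha>"] assms by (simp add: closed invol_invol)

text \<open>The Lukasiewicz identity read at the involutes of \<open>u\<close> and \<open>v\<close>.
  The symmetric term is the meet of \<open>u\<close> and \<open>v\<close>, as the next lemmas
  show.\<close>

lemma meet_commute:
  assumes "u \<in> carrier A" "v \<in> carrier A"
  shows "(u\<^sup>\<alpha> \<otimes> v)\<^sup>\<alpha> \<otimes> v = (v\<^sup>\<alpha> \<otimes> u)\<^sup>\<alpha> \<otimes> u"
  using lukasiewicz[of "u\<^sup>\<alpha>" "v\<^sup>\<alpha>"] assms by (simp add: closed invol_invol)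

lemma meet_lower_right:
  assumes "u \<in> carrier A" "v \<in> carrier A"
  shows "(u\<^sup>\<alpha> \<otimes> v)\<^sup>\<alpha> \<otimes> v \<sqsubseteq>\<^sub>+ v"
  using assms by (simp add: closed mult_le_right)

text \<open>Since \<open>v\<^sup>\<alpha> \<otimes> w\<close> lies below
  \<open>w\<^sup>\<alpha> \<otimes> w = \<zero>\<close>, the meet with its arguments swapped
  collapses to \<open>\<zero>\<^sup>\<alpha> \<otimes> w = w\<close>.\<close>

lemma meet_absorb:
  assumes "w \<in> carrier A" "v \<in> carrier A" "w \<sqsubseteq>\<^sub>+ v"
  shows "(w\<^sup>\<alpha> \<otimes> v)\<^sup>\<alpha> \<otimes> v = w"
proof -
  have "v\<^sup>\<alpha> \<otimes> w \<sqsubseteq>\<^sub>+ w\<^sup>\<alpha> \<otimes> w"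
    using assms by (simp add: closed mult_right_mono invol_antitone)
  then have "v\<^sup>\<alpha> \<otimes> w = \<zero>"
    using assms by (intro join_le_antisym) (simp_all add: closed mult_invol_left zero_least)
  then show ?thesis
    using meet_commute[OF assms(1,2)] assms by (simp add: invol_zero mult_one_left)
qed

text \<open>The meet term is monotone in \<open>u\<close>, which occurs only in left factors and
  under two involutions. Replacing \<open>u\<close> by the smaller \<open>w\<close> gives
  \<open>w\<close> itself by absorption.\<close>

lemma meet_greatest:
  assumes "u \<in> carrier A" "v \<in> carrier A" "w \<in> carrier A" "w \<sqsubseteq>\<^sub>+ u" "w \<sqsubseteq>\<^sub>+ v"
  shows "w \<sqsubseteq>\<^sub>+ (u\<^sup>\<alpha> \<otimes> v)\<^sup>\<alpha> \<otimes> v"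
proof -
  have "u\<^sup>\<alpha> \<otimes> v \<sqsubseteq>\<^sub>+ w\<^sup>\<alpha> \<otimes> v"
    using assms by (simp add: closed mult_right_mono invol_antitone)
  then have "(w\<^sup>\<alpha> \<otimes> v)\<^sup>\<alpha> \<otimes> v \<sqsubseteq>\<^sub>+ (u\<^sup>\<alpha> \<otimes> v)\<^sup>\<alpha> \<otimes> v"
    using assms by (simp add: closed mult_right_mono invol_antitone)
  then show ?thesis
    using assms meet_absorb[of w v] by simp
qed

text \<open>De Morgan: \<open>?m\<close> is the meet of \<open>x\<^sup>\<alpha>\<close> and
  \<open>y\<^sup>\<alpha>\<close>, and the order-reversing involution turns this meet into the join
  of \<open>x\<close> and \<open>y\<close>.\<close>

lemma add_eq_mult_invol:
  assumes x: "x \<in> carrier A" and y: "y \<in> carrier A"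
  shows "x \<oplus> y = ((x \<otimes> y\<^sup>\<alpha>)\<^sup>\<alpha> \<otimes> y\<^sup>\<alpha>)\<^sup>\<alpha>" (is "_ = ?m\<^sup>\<alpha>")
proof (rule join_le_antisym)
  have m: "?m \<in> carrier A"
    using x y by (simp add: closed)
  \<comment> \<open>As written, \<open>?m\<close> has right factor \<open>y\<^sup>\<alpha>\<close>;
    the Lukasiewicz identity rewrites it with right factor \<open>x\<^sup>\<alpha>\<close>, which
    gives the second bound.\<close>
  have "?m \<sqsubseteq>\<^sub>+ y\<^sup>\<alpha>" "?m \<sqsubseteq>\<^sub>+ x\<^sup>\<alpha>"
    using x y meet_lower_right[of "x\<^sup>\<alpha>" "y\<^sup>\<alpha>"] meet_lower_right[of "y\<^sup>\<alpha>" "x\<^sup>\<alpha>"]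
    by (simp_all add: closed invol_invol lukasiewicz[of x y])
  then have "y \<sqsubseteq>\<^sub>+ ?m\<^sup>\<alpha>" "x \<sqsubseteq>\<^sub>+ ?m\<^sup>\<alpha>"
    using invol_antitone[of ?m "y\<^sup>\<alpha>"] invol_antitone[of ?m "x\<^sup>\<alpha>"] x y m
    by (simp_all add: closed invol_invol)
  then show "x \<oplus> y \<sqsubseteq>\<^sub>+ ?m\<^sup>\<alpha>"
    using x y m by (simp add: closed join_least)
  have "(x \<oplus> y)\<^sup>\<alpha> \<sqsubseteq>\<^sub>+ ?m"
    using x y meet_greatest[of "x\<^sup>\<alpha>" "y\<^sup>\<alpha>" "(x \<oplus> y)\<^sup>\<alpha>"]
    by (simp add: closed invol_invol invol_antitone join_upper_left join_upper_right)
  then show "?m\<^sup>\<alpha> \<sqsubseteq>\<^sub>+ x \<oplus> y"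
    using invol_antitone[of "(x \<oplus> y)\<^sup>\<alpha>" ?m] x y m by (simp add: closed invol_invol)
qed (use x y in \<open>simp_all add: closed\<close>)

end

locale lukasiewicz_near_semiring_ideal = lukasiewicz_near_semiring +
  fixes I
  assumes ideal: "near_semiring_ideal I A"
begin

lemma zero_in_ideal: "\<zero> \<in> I"
  using ideal by (simp add: near_semiring_ideal_def)

lemma ideal_rel_carrier:
  assumes "(a, b) \<in> \<theta> I"
  shows "a \<in> carrier A" "b \<in> carrier A"
  using assms by (simp_all add: ideal_rel_def)

lemma ideal_rel_sym: "(a, b) \<in> \<theta> I \<Longrightarrow> (b, a) \<in> \<theta> I"
  by (simp add: ideal_rel_def)

lemma ideal_rel_mult_right:
  assumes "(a, b) \<in> \<theta> I" "c \<in> carrier A"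
  shows "(a \<otimes> c, b \<otimes> c) \<in> \<theta> I"
proof -
  have "a \<in> carrier A" "b \<in> carrier A" "a\<^sup>\<alpha> \<otimes> b \<in> I" "b\<^sup>\<alpha> \<otimes> a \<in> I"
    using assms(1) by (simp_all add: ideal_rel_def)
  \<comment> \<open>(I2) supplies one of the two memberships for \<open>(a, b)\<close>; the other is
    (I2) for \<open>(b, a)\<close>, whose premises are the same pair.\<close>
  then show ?thesis
    using ideal assms(2) mult_closed unfolding near_semiring_ideal_def ideal_rel_def by blast
qed

lemma ideal_rel_mult_left:
  assumes "(a, b) \<in> \<theta> I" "c \<in> carrier A"
  shows "(c \<otimes> a, c \<otimes> b) \<in> \<theta> I"
proof -
  have "a \<in> carrier A" "b \<in> carrier A" "a\<^sup>\<alpha> \<otimes> b \<in> I" "b\<^sup>\<alpha> \<otimes> a \<in> I"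
    using assms(1) by (simp_all add: ideal_rel_def)
  then show ?thesis
    using ideal assms(2) mult_closed unfolding near_semiring_ideal_def ideal_rel_def by blast
qed

lemma ideal_rel_mult_invol:
  assumes "(a, b) \<in> \<theta> I"
  shows "a \<otimes> b\<^sup>\<alpha> \<in> I"
proof -
  have c: "a \<in> carrier A" "b \<in> carrier A"
    using assms by (rule ideal_rel_carrier)+
  then have "(b \<otimes> b\<^sup>\<alpha>)\<^sup>\<alpha> \<otimes> (a \<otimes> b\<^sup>\<alpha>) \<in> I"
    using ideal_rel_mult_right[OF assms, of "b\<^sup>\<alpha>"] by (simp add: ideal_rel_def closed)
  then show ?thesis
    using c by (simp add: closed mult_invol_right invol_zero mult_one_left)
qed

text \<open>Once double involutions cancel, the two memberships to check are
  \<open>a \<otimes> b\<^sup>\<alpha> \<in> I\<close> and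
  \<open>b \<otimes> a\<^sup>\<alpha> \<in> I\<close>.\<close>

lemma ideal_rel_invol:
  assumes "(a, b) \<in> \<theta> I"
  shows "(a\<^sup>\<alpha>, b\<^sup>\<alpha>) \<in> \<theta> I"
  using ideal_rel_carrier[OF assms] ideal_rel_mult_invol[OF assms]
    ideal_rel_mult_invol[OF ideal_rel_sym[OF assms]]
  by (simp add: ideal_rel_def closed invol_invol)

lemma ideal_saturated:
  assumes "(a, b) \<in> \<theta> I" "b \<in> I"
  shows "a \<in> I"
  using ideal_rel_carrier[OF assms(1)] ideal_rel_mult_invol[OF assms(1)] assms(2) ideal
  unfolding near_semiring_ideal_def by blast

lemma ideal_rel_trans:
  assumes ab: "(a, b) \<in> \<theta> I" and bc: "(b, c) \<in> \<theta> I"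
  shows "(a, c) \<in> \<theta> I"
proof -
  \<comment> \<open>Stated for arbitrary chains because it is used twice: for \<open>a, b, c\<close>
    and for the reversed chain \<open>c, b, a\<close>.\<close>
  have half: "x\<^sup>\<alpha> \<otimes> z \<in> I" if xy: "(x, y) \<in> \<theta> I" and yz: "(y, z) \<in> \<theta> I" for x y z
  proof (rule ideal_saturated)
    show "(x\<^sup>\<alpha> \<otimes> z, y\<^sup>\<alpha> \<otimes> z) \<in> \<theta> I"
      using ideal_rel_mult_right[OF ideal_rel_invol[OF xy]] ideal_rel_carrier[OF yz] by blast
    show "y\<^sup>\<alpha> \<otimes> z \<in> I"
      using yz by (simp add: ideal_rel_def)
  qed
  show ?thesis
    using half[OF ab bc] half[OF ideal_rel_sym[OF bc] ideal_rel_sym[OF ab]]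
      ideal_rel_carrier[OF ab] ideal_rel_carrier[OF bc]
    by (simp add: ideal_rel_def)
qed

lemma equiv_ideal_rel: "equiv (carrier A) (\<theta> I)"
proof (rule equivI)
  show "\<theta> I \<subseteq> carrier A \<times> carrier A"
    by (auto simp: ideal_rel_def)
  show "refl_on (carrier A) (\<theta> I)"
    by (auto simp: refl_on_def ideal_rel_def mult_invol_left zero_in_ideal)
  show "sym (\<theta> I)"
    by (auto intro: symI ideal_rel_sym)
  show "trans (\<theta> I)"
    by (auto intro: transI ideal_rel_trans)
qed

text \<open>Change one factor at a time, passing through \<open>b \<otimes> c\<close>.\<close>

lemma ideal_rel_mult:
  assumes "(a, b) \<in> \<theta> I" "(c, d) \<in> \<theta> I"
  shows "(a \<otimes> c, b \<otimes> d) \<in> \<theta> I"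
  using ideal_rel_trans ideal_rel_mult_right[OF assms(1)] ideal_rel_mult_left[OF assms(2)]
    ideal_rel_carrier[OF assms(1)] ideal_rel_carrier[OF assms(2)]
  by blast

lemma ideal_rel_add:
  assumes "(a, b) \<in> \<theta> I" "(c, d) \<in> \<theta> I"
  shows "(a \<oplus> c, b \<oplus> d) \<in> \<theta> I"
  using assms ideal_rel_carrier[OF assms(1)] ideal_rel_carrier[OF assms(2)]
  by (simp add: add_eq_mult_invol ideal_rel_mult ideal_rel_invol)

lemma near_semiring_congruence_ideal_rel: "near_semiring_congruence (\<theta> I) A"
  unfolding near_semiring_congruence_def
  using equiv_ideal_rel ideal_rel_add ideal_rel_mult ideal_rel_invol by blast

lemma ideal_rel_class_zero: "\<theta> I `` {\<zero>} = I"
proof -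
  have "I \<subseteq> carrier A"
    using ideal unfolding near_semiring_ideal_def by blast
  \<comment> \<open>Here \<open>\<zero>\<^sup>\<alpha> \<otimes> x = x\<close> and
    \<open>x\<^sup>\<alpha> \<otimes> \<zero> = \<zero>\<close>, so being related to
    \<open>\<zero>\<close> reduces to \<open>x \<in> I\<close>.\<close>
  then show ?thesis
    using zero_in_ideal
    by (auto simp: ideal_rel_def closed invol_zero mult_one_left mult_zero_right)
qed

end

theorem theorem2:
  fixes A :: "('a, 'm) iota_algebra_scheme" and I :: "'a set"
  assumes "lukasiewicz_near_semiring A"
    and "near_semiring_ideal I A"
  shows "near_semiring_congruence (\<theta>\<^bsub>A\<^esub> I) A \<and> (\<theta>\<^bsub>A\<^esub> I) `` {\<zero>\<^bsub>A\<^esub>} = I"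
proof -
  interpret lukasiewicz_near_semiring_ideal A I
    using assms
    by (simp add: lukasiewicz_near_semiring_ideal_def lukasiewicz_near_semiring_ideal_axioms_def)
  show ?thesis
    using near_semiring_congruence_ideal_rel ideal_rel_class_zero by simp
qed

end
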